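(* Assume that $\nabla f:X\to X$ is $\alpha$-strongly monotone for some $\alpha>0$, i.e. $\langle\nabla f(x)-\nabla f(y),x-y\rangle_X\ge\alpha\|x-y\|_X^2$ for all $x,y\in X$, and that the set $S\times M$ of saddle points of $L$ is non-empty. Let $(x,\lambda):[0,+\infty)\to X\times Y$ be a solution of the Arrow--Hurwicz differential system (AH). Then, for any $(\xi,\eta)\in S\times M$, $$L(x(t),\eta)-L(\xi,\lambda(t))=o\Big(\frac1{\sqrt t}\Big)\quad\text{as } t\to+\infty,$$ $$\|(\dot x(t),\dot\lambda(t))\|=o\Big(\frac1{\sqrt t}\Big)\quad\text{as } t\to+\infty .$$ Moreover, there exists $(\bar x,\bar\lambda)\in S\times M$ such that $(x(t),\lambda(t))\rightharpoonup(\bar x,\bar\lambda)$ weakly in $X\times Y$ as $t\to+\infty$.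
   Context: $X$ and $Y$ are real Hilbert spaces with inner products $\langle\cdot,\cdot\rangle_X$, $\langle\cdot,\cdot\rangle_Y$ and norms $\|\cdot\|_X,\|\cdot\|_Y$; $X\times Y$ carries the product Hilbert structure, with norm $\|\cdot\|$. Standing assumptions: $f:X\to\mathbb R$ is convex and continuously differentiable; $\nabla f:X\to X$ is Lipschitz continuous on bounded sets; $A:X\to Y$ is linear and continuous with adjoint $A^*$; $b\in Y$. The Lagrangian is $L:X\times Y\to\mathbb R$, $L(x,\lambda)=f(x)+\langle\lambda,Ax-b\rangle_Y$. A saddle point of $L$ is a pair $(\bar x,\bar\lambda)\in X\times Y$ with $L(\bar x,\lambda)\le L(\bar x,\bar\lambda)\le L(x,\bar\lambda)$ for all $(x,\lambda)\in X\times Y$; the set of saddle points of $L$ is denoted by $S\times M\subset X\times Y$. The system (AH) is $$\dot x+\nabla f(x)+A^*\lambda=0_X,\qquad \dot\lambda+b-Ax=0_Y,$$ with initial data $(x(0),\lambda(0))=(x_0,\lambda_0)\in X\times Y$; a solution is a function $(x,\lambda)\in\mathcal C^1([0,+\infty);X\times Y)$ satisfying the system on $[0,+\infty)$ with these initial data. *)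

theory Defs
  imports "HOL-Analysis.Analysis" "HOL-Library.Landau_Symbols"
begin

text \<open>
  Real Hilbert spaces are rendered as types of sort \<open>{real_inner, complete_space}\<close>. The inner product
  and norm on the product type are the library's, i.e. the Hilbert product structure.
\<close>

text \<open>
  The gradient is the Riesz representative of the Frechet derivative; it is unique when it exists,
  and on a Hilbert space it exists wherever \<open>f\<close> is differentiable.
\<close>

definition gradient :: "('a::real_inner \<Rightarrow> real) \<Rightarrow> 'a \<Rightarrow> 'a" where
  "gradient f x = (THE D. GDERIV f x :> D)"

definition continuously_differentiable :: "('a::{real_inner, complete_space} \<Rightarrow> real) \<Rightarrow> bool" where
  "continuously_differentiable f \<longleftrightarrow>
     (\<forall>x. f differentiable (at x)) \<and> continuous_on UNIV (gradient f)"

definition lipschitz_on_bounded_sets ::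
    "('a::real_normed_vector \<Rightarrow> 'b::real_normed_vector) \<Rightarrow> bool" where
  "lipschitz_on_bounded_sets F \<longleftrightarrow> (\<forall>B. bounded B \<longrightarrow> (\<exists>C. C-lipschitz_on B F))"

definition strongly_monotone :: "real \<Rightarrow> ('a::real_inner \<Rightarrow> 'a) \<Rightarrow> bool" where
  "strongly_monotone \<alpha> F \<longleftrightarrow> (\<forall>x y. inner (F x - F y) (x - y) \<ge> \<alpha> * (norm (x - y))\<^sup>2)"

definition lagrangian ::
    "('a::real_inner \<Rightarrow> real) \<Rightarrow> ('a \<Rightarrow> 'b::real_inner) \<Rightarrow> 'b \<Rightarrow> 'a \<Rightarrow> 'b \<Rightarrow> real" where
  "lagrangian f A b x l = f x + inner l (A x - b)"

definition saddle_points :: "('a \<Rightarrow> 'b \<Rightarrow> real) \<Rightarrow> ('a \<times> 'b) set" where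
  "saddle_points L = {(xb, lb). \<forall>x l. L xb l \<le> L xb lb \<and> L xb lb \<le> L x lb}"

text \<open>
  Unlike the library's \<open>C1_differentiable_on\<close>, which uses two-sided derivatives, derivatives are
  taken within \<open>S\<close>; on \<open>{0..}\<close> this is the one-sided derivative at \<open>0\<close>, so that values at negative
  times are irrelevant.
\<close>

definition C1_within :: "real set \<Rightarrow> (real \<Rightarrow> 'a::real_normed_vector) \<Rightarrow> bool" where
  "C1_within S z \<longleftrightarrow>
     (\<exists>D. (\<forall>t\<in>S. (z has_vector_derivative D t) (at t within S)) \<and> continuous_on S D)"

abbreviation time_derivative :: "(real \<Rightarrow> 'a::real_normed_vector) \<Rightarrow> real \<Rightarrow> 'a" where
  "time_derivative z t \<equiv> vector_derivative z (at t within {0..})"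

definition AH_solution ::
    "('a::{real_inner, complete_space} \<Rightarrow> real) \<Rightarrow> ('a \<Rightarrow> 'b::{real_inner, complete_space}) \<Rightarrow> 'b \<Rightarrow>
     'a \<Rightarrow> 'b \<Rightarrow> (real \<Rightarrow> 'a) \<Rightarrow> (real \<Rightarrow> 'b) \<Rightarrow> bool" where
  "AH_solution f A b x0 l0 x l \<longleftrightarrow>
     C1_within {0..} (\<lambda>t. (x t, l t)) \<and>
     (\<forall>t\<ge>0. time_derivative x t + gradient f (x t) + adjoint A (l t) = 0 \<and>
            time_derivative l t + b - A (x t) = 0) \<and>
     x 0 = x0 \<and> l 0 = l0"

definition weakly_tendsto :: "('t \<Rightarrow> 'a::real_normed_vector) \<Rightarrow> 'a \<Rightarrow> 't filter \<Rightarrow> bool" where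
  "weakly_tendsto z zb F \<longleftrightarrow>
     (\<forall>\<phi> :: 'a \<Rightarrow> real. bounded_linear \<phi> \<longrightarrow> ((\<lambda>t. \<phi> (z t)) \<longlongrightarrow> \<phi> zb) F)"

end

theory Submission
  imports Defs
begin

text \<open>
  Fix a saddle point \<open>\<zeta> = (\<xi>, \<eta>)\<close>, let \<open>z = (x, \<lambda>)\<close> and let \<open>K\<close> be a bound for \<open>A\<close>. Shifted trajectories and
  stationary points are again trajectories, and \<open>\<parallel>z\<^sub>1 - z\<^sub>2\<parallel>\<^sup>2\<close> has derivative at most
  \<open>-2\<alpha> \<parallel>x\<^sub>1 - x\<^sub>2\<parallel>\<^sup>2\<close> along two trajectories. Hence \<open>E = \<parallel>z'\<parallel>\<^sup>2\<close> and \<open>V = \<parallel>z - \<zeta>\<parallel>\<^sup>2\<close> are nonincreasing,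
  and their decay controls the integrals of \<open>\<parallel>x'\<parallel>\<^sup>2\<close> and of \<open>\<parallel>\<lambda>'\<parallel>\<^sup>2 = \<parallel>A (x - \<xi>)\<parallel>\<^sup>2\<close>, so that
  \<open>(t - s) E(t) \<le> (E(s) - E(t)) / (2\<alpha>) + K\<^sup>2 (V(s) - V(t)) / \<alpha>\<close>. With \<open>s = t / 2\<close> this gives
  \<open>t E(t) \<rightarrow> 0\<close>. As \<open>E\<close> need not be differentiable, the estimate is derived for difference quotients.
  Convexity bounds the Lagrangian gap by \<open>\<langle>\<nabla>f(x) - \<nabla>f(\<xi>), x - \<xi>\<rangle> = -\<langle>z', z - \<zeta>\<rangle>\<close>, which also
  forces \<open>x \<rightarrow> \<xi>\<close> strongly.
\<close>

section \<open>Projections and the Riesz representation\<close>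

lemma subspace_closure:
  fixes S :: "'a::real_normed_vector set"
  assumes "subspace S"
  shows "subspace (closure S)"
proof (rule subspaceI)
  show "0 \<in> closure S"
    using assms subspace_0 closure_subset by blast
next
  fix u v assume "u \<in> closure S" "v \<in> closure S"
  then obtain p q where "\<forall>n. p n \<in> S" "p \<longlonglongrightarrow> u" "\<forall>n. q n \<in> S" "q \<longlonglongrightarrow> v"
    by (auto simp: closure_sequential)
  then have "(\<lambda>n. p n + q n) \<longlonglongrightarrow> u + v" "\<forall>n. p n + q n \<in> S"
    using assms by (auto intro: tendsto_add subspace_add)
  then show "u + v \<in> closure S"
    by (auto simp: closure_sequential intro!: exI[of _ "\<lambda>n. p n + q n"])
next
  fix c u assume "u \<in> closure S"
  then obtain p where "\<forall>n. p n \<in> S" "p \<longlonglongrightarrow> u"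
    by (auto simp: closure_sequential)
  then have "(\<lambda>n. c *\<^sub>R p n) \<longlonglongrightarrow> c *\<^sub>R u" "\<forall>n. c *\<^sub>R p n \<in> S"
    using assms by (auto intro: tendsto_scaleR subspace_scale)
  then show "c *\<^sub>R u \<in> closure S"
    by (auto simp: closure_sequential intro!: exI[of _ "\<lambda>n. c *\<^sub>R p n"])
qed

text \<open>The parallelogram law for \<open>x - p\<close> and \<open>x - q\<close>. The midpoint
  term is the one that a distance bound controls when \<open>p\<close> and \<open>q\<close> lie in a
  subspace, which makes minimizing sequences Cauchy.\<close>

lemma norm_diff_parallelogram:
  fixes x p q :: "'a::real_inner"
  shows "(norm (p - q))\<^sup>2 = 2 * (norm (x - p))\<^sup>2 + 2 * (norm (x - q))\<^sup>2
    - 4 * (norm (x - (1/2) *\<^sub>R (p + q)))\<^sup>2"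
  unfolding power2_norm_eq_inner
  by (simp add: inner_diff_left inner_diff_right inner_add_left inner_add_right inner_commute
      algebra_simps)

text \<open>A sequence in \<open>S\<close> whose distance to \<open>x\<close> tends to the infimum
  is Cauchy by the parallelogram law; its limit is a nearest point, and varying that point along
  \<open>v\<close> forces orthogonality.\<close>

lemma closed_subspace_orthogonal_projection:
  fixes S :: "'a::{real_inner, complete_space} set"
  assumes "closed S" "subspace S"
  obtains p where "p \<in> S" "\<And>v. v \<in> S \<Longrightarrow> inner (x - p) v = 0"
proof -
  have ne: "S \<noteq> {}"
    using assms(2) subspace_0 by blast
  define d where "d = infdist x S"
  have d_le: "d \<le> norm (x - v)" if "v \<in> S" for v
    using infdist_le[OF that, of x] by (simp add: d_def dist_norm)
  have d0: "0 \<le> d"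
    by (simp add: d_def infdist_nonneg)
  have "\<exists>v\<in>S. norm (x - v) < d + 1 / real (Suc n)" for n
  proof -
    have "infdist x S < d + 1 / real (Suc n)"
      by (simp add: d_def)
    then show ?thesis
      using ne cINF_less_iff[of S "dist x"] bdd_belowI2[of S 0 "dist x"]
      by (auto simp: infdist_def dist_norm simp del: of_nat_Suc)
  qed
  then obtain p where p: "\<And>n. p n \<in> S" "\<And>n. norm (x - p n) < d + 1 / real (Suc n)"
    by metis
  have lim: "(\<lambda>n. norm (x - p n)) \<longlonglongrightarrow> d"
  proof (rule tendsto_sandwich[OF _ _ tendsto_const])
    show "(\<lambda>n. d + 1 / real (Suc n)) \<longlonglongrightarrow> d"
      using tendsto_add[OF tendsto_const LIMSEQ_Suc[OF lim_1_over_n], of d] by simp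
  qed (use p d_le in \<open>auto simp del: of_nat_Suc intro!: always_eventually less_imp_le\<close>)
  have dist2: "(norm (p m - p n))\<^sup>2 \<le> 2 * ((norm (x - p m))\<^sup>2 - d\<^sup>2) + 2 * ((norm (x - p n))\<^sup>2 - d\<^sup>2)"
    for m n
  proof -
    have "(1/2) *\<^sub>R (p m + p n) \<in> S"
      using assms(2) p(1) by (simp add: subspace_add subspace_scale)
    then have "d\<^sup>2 \<le> (norm (x - (1/2) *\<^sub>R (p m + p n)))\<^sup>2"
      using d0 d_le by (intro power_mono) auto
    then show ?thesis
      unfolding norm_diff_parallelogram[of "p m" "p n" x] by simp
  qed
  have "Cauchy p"
  proof (rule metric_CauchyI)
    fix e :: real assume "0 < e"
    have "(\<lambda>n. (norm (x - p n))\<^sup>2 - d\<^sup>2) \<longlonglongrightarrow> d\<^sup>2 - d\<^sup>2"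
      by (intro tendsto_intros lim)
    then have "\<forall>\<^sub>F n in sequentially. (norm (x - p n))\<^sup>2 - d\<^sup>2 < e\<^sup>2 / 4"
      by (rule order_tendstoD) (use \<open>0 < e\<close> in simp)
    then obtain M where M: "\<And>n. n \<ge> M \<Longrightarrow> (norm (x - p n))\<^sup>2 - d\<^sup>2 < e\<^sup>2 / 4"
      by (auto simp: eventually_sequentially)
    have "dist (p m) (p n) < e" if "m \<ge> M" "n \<ge> M" for m n
    proof -
      have "(norm (p m - p n))\<^sup>2 < e\<^sup>2"
        using dist2[of m n] M[OF that(1)] M[OF that(2)] by (simp add: field_simps)
      then show ?thesis
        using \<open>0 < e\<close> power2_less_imp_less by (fastforce simp: dist_norm)
    qed
    then show "\<exists>M. \<forall>m\<ge>M. \<forall>n\<ge>M. dist (p m) (p n) < e"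
      by blast
  qed
  then obtain P where P: "p \<longlonglongrightarrow> P"
    using Cauchy_convergent convergent_def by blast
  have PS: "P \<in> S"
    using assms(1) p(1) P closed_sequentially by blast
  have "(\<lambda>n. norm (x - p n)) \<longlonglongrightarrow> norm (x - P)"
    by (intro tendsto_intros P)
  then have Pd: "norm (x - P) = d"
    using lim LIMSEQ_unique by blast
  have "inner (x - P) v = 0" if "v \<in> S" for v
  proof (cases "v = 0")
    case False
    \<comment> \<open>The step length that minimizes the distance from \<open>x\<close> along the
      line through \<open>P\<close> in direction \<open>v\<close>; a nonzero inner product would
      bring the distance below \<open>d\<close>.\<close>
    define t where "t = inner (x - P) v / inner v v"
    have "P + t *\<^sub>R v \<in> S"
      using PS that assms(2) by (simp add: subspace_add subspace_scale)
    then have "(norm (x - P))\<^sup>2 \<le> (norm (x - (P + t *\<^sub>R v)))\<^sup>2"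
      using d_le Pd d0 by (intro power_mono) auto
    also have "\<dots> = (norm (x - P))\<^sup>2 - 2 * t * inner (x - P) v + t * t * inner v v"
      unfolding power2_norm_eq_inner
      by (simp add: inner_diff_left inner_diff_right inner_add_left inner_add_right inner_commute
          algebra_simps)
    also have "\<dots> = (norm (x - P))\<^sup>2 - (inner (x - P) v)\<^sup>2 / inner v v"
      using False by (simp add: t_def power2_eq_square)
    finally have "(inner (x - P) v)\<^sup>2 / inner v v \<le> 0"
      by simp
    moreover have "inner v v > 0"
      using False by simp
    ultimately show ?thesis
      by (simp add: divide_le_0_iff)
  qed simp
  with PS that show ?thesis
    by blast
qed

text \<open>The kernel of \<open>\<phi>\<close> is closed, so a vector outside it has a nonzero
  component \<open>e\<close> orthogonal to it. Every \<open>v\<close> differs from a multiple of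
  \<open>e\<close> by a kernel element, so a rescaled \<open>e\<close> represents
  \<open>\<phi>\<close>.\<close>

theorem riesz_representation:
  fixes \<phi> :: "'a::{real_inner, complete_space} \<Rightarrow> real"
  assumes "bounded_linear \<phi>"
  obtains w where "\<And>v. \<phi> v = inner v w"
proof (cases "\<forall>v. \<phi> v = 0")
  case True
  then show ?thesis
    using that[of 0] by simp
next
  case False
  interpret bounded_linear \<phi> by fact
  obtain u where u: "\<phi> u \<noteq> 0"
    using False by blast
  have "closed {v. \<phi> v = 0}"
    by (intro closed_Collect_eq continuous_intros continuous_on)
  moreover have "subspace {v. \<phi> v = 0}"
    by (auto simp: subspace_def add scale zero)
  ultimately obtain p where p: "\<phi> p = 0" "\<And>v. \<phi> v = 0 \<Longrightarrow> inner (u - p) v = 0"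
    using closed_subspace_orthogonal_projection[of "{v. \<phi> v = 0}" u] by auto
  define e where "e = u - p"
  have e: "\<phi> e \<noteq> 0"
    using u p by (simp add: e_def diff)
  then have e0: "inner e e \<noteq> 0"
    by (auto simp: zero)
  have "\<phi> v = inner v ((\<phi> e / inner e e) *\<^sub>R e)" for v
  proof -
    have "\<phi> (v - (\<phi> v / \<phi> e) *\<^sub>R e) = 0"
      using e by (simp add: diff scale)
    then have "inner e (v - (\<phi> v / \<phi> e) *\<^sub>R e) = 0"
      using p by (simp add: e_def)
    then have "inner v e = (\<phi> v / \<phi> e) * inner e e"
      by (simp add: inner_diff_right inner_commute)
    then show ?thesis
      using e e0 by simp
  qed
  then show ?thesis
    using that by blast
qed

text \<open>\<open>adjoint\<close> is a choice operator, so its defining identity holds once some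
  adjoint exists; Riesz, applied for each \<open>v\<close>, supplies one.\<close>

lemma adjoint_works_Hilbert:
  fixes A :: "'a::{real_inner, complete_space} \<Rightarrow> 'b::real_inner"
  assumes "bounded_linear A"
  shows "inner (A u) v = inner u (adjoint A v)"
proof -
  have "\<exists>w. \<forall>u. inner (A u) v = inner u w" for v
  proof -
    have "bounded_linear (\<lambda>u. inner (A u) v)"
      using bounded_linear_inner_left_comp[OF assms] .
    from riesz_representation[OF this] show ?thesis
      by metis
  qed
  then obtain B where "\<forall>u v. inner (A u) v = inner u (B v)"
    by metis
  with adjoint_unique[OF this] show ?thesis
    by simp
qed

text \<open>Makes the definite description in \<open>gradient\<close> meaningful: existence is Riesz
  for the Frechet derivative, uniqueness is that of the derivative.\<close>

lemma GDERIV_gradient: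
  fixes f :: "'a::{real_inner, complete_space} \<Rightarrow> real"
  assumes "f differentiable (at x)"
  shows "GDERIV f x :> gradient f x"
proof -
  obtain D where D: "(f has_derivative D) (at x)"
    using assms differentiable_def by blast
  obtain w where w: "\<And>h. D h = inner h w"
    using riesz_representation[OF has_derivative_bounded_linear[OF D]] by blast
  have 1: "GDERIV f x :> w"
    using D unfolding gderiv_def w[abs_def] .
  have "v = w" if "GDERIV f x :> v" for v
  proof -
    have "(\<lambda>h. inner h v) = (\<lambda>h. inner h w)"
      using has_derivative_unique that 1 unfolding gderiv_def by blast
    then have "inner (v - w) v = inner (v - w) w"
      by metis
    then have "inner (v - w) (v - w) = 0"
      by (simp add: inner_diff_right)
    then show ?thesis
      by simp
  qed
  with 1 show ?thesis
    unfolding gradient_def by (rule theI)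
qed

section \<open>Derivatives and limits on a half-line\<close>

text \<open>Mean value theorem. \<open>S\<close> may exceed the segment because derivatives along
  trajectories are taken within \<open>{0..}\<close>.\<close>

lemma nonincreasing_on_segment:
  fixes g :: "real \<Rightarrow> real"
  assumes "\<And>r. r \<in> {s..t} \<Longrightarrow> \<exists>D\<le>0. (g has_real_derivative D) (at r within S)"
    and "s \<le> t" "{s..t} \<subseteq> S"
  shows "g t \<le> g s"
proof -
  obtain D where D: "\<And>r. r \<in> {s..t} \<Longrightarrow> D r \<le> 0"
      "\<And>r. r \<in> {s..t} \<Longrightarrow> (g has_real_derivative D r) (at r within S)"
    using assms(1) by metis
  have "\<exists>r\<in>{s..t}. g t - g s = D r * (t - s)"
  proof (rule mvt_very_simple[OF assms(2)])
    fix r assume "s \<le> r" "r \<le> t"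
    then have "(g has_real_derivative D r) (at r within {s..t})"
      using D(2)[of r] assms(3) by (auto intro: DERIV_subset)
    then show "(g has_derivative (*) (D r)) (at r within {s..t})"
      by (simp add: has_field_derivative_def)
  qed
  then obtain r where "r \<in> {s..t}" "g t - g s = D r * (t - s)" ..
  moreover have "D r * (t - s) \<le> 0"
    using D(1)[OF \<open>r \<in> {s..t}\<close>] assms(2) by (simp add: mult_nonpos_nonneg)
  ultimately show ?thesis
    by simp
qed

lemma has_vector_derivative_at_right_quotient:
  assumes "(u has_vector_derivative d) (at_right t)"
  shows "((\<lambda>h. (1 / h) *\<^sub>R (u (t + h) - u t)) \<longlongrightarrow> d) (at_right 0)"
proof -
  have "((\<lambda>r. (1 / norm (r - t)) *\<^sub>R (u r - (u t + (r - t) *\<^sub>R d))) \<longlongrightarrow> 0) (at_right t)"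
    using assms unfolding has_vector_derivative_def has_derivative_within by blast
  then have "((\<lambda>h. (1 / norm h) *\<^sub>R (u (h + t) - (u t + h *\<^sub>R d))) \<longlongrightarrow> 0) (at_right 0)"
    unfolding filterlim_at_right_to_0[of _ _ t] by simp
  moreover have "\<forall>\<^sub>F h in at_right 0. (1 / norm h) *\<^sub>R (u (h + t) - (u t + h *\<^sub>R d)) =
      (1 / h) *\<^sub>R (u (t + h) - u t) - d"
    using eventually_at_right_less[of 0]
    by eventually_elim (simp add: algebra_simps)
  ultimately show ?thesis
    by (subst LIM_zero_iff[symmetric]) (rule Lim_transform_eventually)
qed

text \<open>\<open>H\<close> has a limit, being monotone and bounded below, and
  \<open>H (t / 2)\<close> shares it. This turns an energy estimate on the interval from
  \<open>t / 2\<close> to \<open>t\<close> into decay faster than \<open>1 / t\<close>.\<close>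

lemma tendsto_half_diff_nonincreasing:
  fixes H :: "real \<Rightarrow> real"
  assumes mono: "\<And>s t. 0 \<le> s \<Longrightarrow> s \<le> t \<Longrightarrow> H t \<le> H s" and nonneg: "\<And>t. 0 \<le> t \<Longrightarrow> 0 \<le> H t"
  shows "((\<lambda>t. H (t / 2) - H t) \<longlongrightarrow> 0) at_top"
proof -
  define m where "m = Inf (H ` {0..})"
  have bdd: "bdd_below (H ` {0..})"
    using nonneg by (auto intro!: bdd_belowI)
  have lim: "(H \<longlongrightarrow> m) at_top"
  proof (rule decreasing_tendsto)
    show "\<forall>\<^sub>F t in at_top. m \<le> H t"
      using eventually_ge_at_top[of 0]
      by eventually_elim (auto simp: m_def intro!: cINF_lower[OF bdd])
  next
    fix c assume "m < c"
    then obtain s where s: "s \<ge> 0" "H s < c"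
      unfolding m_def using cINF_less_iff[OF _ bdd] by auto
    show "\<forall>\<^sub>F t in at_top. H t < c"
      using eventually_ge_at_top[of s]
      by eventually_elim (rule le_less_trans[OF mono[OF s(1)] s(2)])
  qed
  have "filterlim (\<lambda>t::real. t / 2) at_top at_top"
    using filterlim_tendsto_pos_mult_at_top[OF tendsto_const[of "1/2"] _ filterlim_ident] by simp
  then have "((\<lambda>t. H (t / 2)) \<longlongrightarrow> m) at_top"
    using filterlim_compose[OF lim] by blast
  from tendsto_diff[OF this lim] show ?thesis
    by simp
qed

section \<open>Weak convergence tested by inner products, and decay rates\<close>

lemma weakly_tendsto_iff_inner:
  fixes z :: "'t \<Rightarrow> 'a::{real_inner, complete_space}"
  shows "weakly_tendsto z zb F \<longleftrightarrow> (\<forall>w. ((\<lambda>t. inner (z t - zb) w) \<longlongrightarrow> 0) F)"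
proof -
  have "(\<lambda>t. inner (z t - zb) w) = (\<lambda>t. inner (z t) w - inner zb w)" for w
    by (simp add: inner_diff_left)
  then have *: "((\<lambda>t. inner (z t - zb) w) \<longlongrightarrow> 0) F \<longleftrightarrow> ((\<lambda>t. inner (z t) w) \<longlongrightarrow> inner zb w) F" for w
    by (simp add: LIM_zero_iff)
  show ?thesis
    unfolding * weakly_tendsto_def
  proof (intro iffI allI impI)
    fix \<phi> :: "'a \<Rightarrow> real"
    assume lim: "\<forall>w. ((\<lambda>t. inner (z t) w) \<longlongrightarrow> inner zb w) F" and "bounded_linear \<phi>"
    then obtain w where "\<And>v. \<phi> v = inner v w"
      using riesz_representation by blast
    then show "((\<lambda>t. \<phi> (z t)) \<longlongrightarrow> \<phi> zb) F"
      using lim by simp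
  qed (use bounded_linear_inner_left in blast)
qed

text \<open>Boundedness of \<open>u\<close> makes the error of replacing \<open>w\<close> by a
  nearby \<open>v\<close> in \<open>S\<close> uniform in \<open>t\<close>.\<close>

lemma tendsto_inner_closure:
  fixes u :: "'t \<Rightarrow> 'a::real_inner"
  assumes bdd: "\<forall>\<^sub>F t in F. norm (u t) \<le> C"
    and lim: "\<And>w. w \<in> S \<Longrightarrow> ((\<lambda>t. inner (u t) w) \<longlongrightarrow> 0) F"
    and w: "w \<in> closure S"
  shows "((\<lambda>t. inner (u t) w) \<longlongrightarrow> 0) F"
proof (rule tendstoI)
  fix e :: real assume "0 < e"
  \<comment> \<open>Adding 1 keeps \<open>k\<close> positive when \<open>C\<close> is 0, so that
    \<open>d\<close> is well defined and positive.\<close>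
  define k where "k = \<bar>C\<bar> + 1"
  define d where "d = e / (2 * k)"
  have "0 < k"
    by (simp add: k_def)
  then have "0 < d"
    using \<open>0 < e\<close> by (simp add: d_def)
  then obtain v where v: "v \<in> S" "dist v w < d"
    using w closure_approachable by blast
  have "\<forall>\<^sub>F t in F. \<bar>inner (u t) v\<bar> < e / 2"
    using tendstoD[OF lim[OF v(1)], of "e / 2"] \<open>0 < e\<close> by simp
  with bdd show "\<forall>\<^sub>F t in F. dist (inner (u t) w) 0 < e"
  proof eventually_elim
    case (elim t)
    have "\<bar>inner (u t) (w - v)\<bar> \<le> norm (u t) * norm (w - v)"
      by (rule Cauchy_Schwarz_ineq2)
    also have "\<dots> \<le> k * d"
      using elim(1) v(2) by (intro mult_mono) (auto simp: k_def dist_norm norm_minus_commute)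
    also have "\<dots> = e / 2"
      using \<open>0 < k\<close> by (simp add: d_def)
    finally have "\<bar>inner (u t) w - inner (u t) v\<bar> \<le> e / 2"
      by (simp only: inner_diff_right)
    then show ?case
      using elim(2) unfolding dist_real_def by linarith
  qed
qed

lemma tendsto_0_if_smallo_inverse_sqrt:
  fixes g :: "real \<Rightarrow> real"
  assumes "g \<in> o[at_top](\<lambda>t. 1 / sqrt t)"
  shows "(g \<longlongrightarrow> 0) at_top"
proof -
  have "((\<lambda>t. 1 / sqrt t) \<longlongrightarrow> 0) at_top"
    by (intro tendsto_divide_0[OF tendsto_const] filterlim_at_top_imp_at_infinity sqrt_at_top)
  from tendsto_mult[OF smalloD_tendsto[OF assms] this]
  have "((\<lambda>t. g t / (1 / sqrt t) * (1 / sqrt t)) \<longlongrightarrow> 0) at_top"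
    by simp
  moreover have "\<forall>\<^sub>F t in at_top. g t / (1 / sqrt t) * (1 / sqrt t) = g t"
    using eventually_gt_at_top[of 0] by eventually_elim simp
  ultimately show ?thesis
    by (rule Lim_transform_eventually)
qed

lemma has_real_derivative_norm_squared:
  fixes u :: "real \<Rightarrow> 'a::real_inner"
  assumes "(u has_vector_derivative u') (at t within S)"
  shows "((\<lambda>t. (norm (u t))\<^sup>2) has_real_derivative 2 * inner u' (u t)) (at t within S)"
proof -
  have "((\<lambda>t. inner (u t) (u t)) has_derivative (\<lambda>h. inner (u t) (h *\<^sub>R u') + inner (h *\<^sub>R u') (u t)))
      (at t within S)"
    using assms has_derivative_inner unfolding has_vector_derivative_def by blast
  moreover have "(\<lambda>h. inner (u t) (h *\<^sub>R u') + inner (h *\<^sub>R u') (u t)) = (*) (2 * inner u' (u t))"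
    by (auto simp: inner_commute)
  ultimately show ?thesis
    by (simp add: has_field_derivative_def power2_norm_eq_inner)
qed

section \<open>The Arrow--Hurwicz flow\<close>

text \<open>\<open>G\<close> plays the role of \<open>\<nabla>f\<close> and \<open>B\<close> that of \<open>A\<^sup>*\<close>.\<close>

locale arrow_hurwicz =
  fixes G :: "'a::{real_inner, complete_space} \<Rightarrow> 'a"
    and A :: "'a \<Rightarrow> 'b::{real_inner, complete_space}"
    and B :: "'b \<Rightarrow> 'a" and b :: 'b and \<alpha> :: real
  assumes pos: "\<alpha> > 0"
    and mono: "\<And>u v. inner (G u - G v) (u - v) \<ge> \<alpha> * (norm (u - v))\<^sup>2"
    and A: "bounded_linear A"
    and adj: "\<And>u v. inner (A u) v = inner u (B v)"
begin

text \<open>Only the differential equation is recorded, so that time shifts and stationary points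
  are instances as well.\<close>

definition trajectory :: "(real \<Rightarrow> 'a) \<Rightarrow> (real \<Rightarrow> 'b) \<Rightarrow> bool" where
  "trajectory x l \<longleftrightarrow> (\<forall>t\<ge>0. (x has_vector_derivative - G (x t) - B (l t)) (at t within {0..}) \<and>
     (l has_vector_derivative A (x t) - b) (at t within {0..}))"

abbreviation velocity :: "'a \<Rightarrow> 'b \<Rightarrow> 'a \<times> 'b" where
  "velocity u v \<equiv> (- G u - B v, A u - b)"

section \<open>Monotonicity of the vector field and contraction of trajectories\<close>

lemma B_diff: "inner u (B v - B w) = inner (A u) (v - w)"
  by (simp add: adj inner_diff_right)

lemma A_diff: "A (u - v) = A u - A v"
  using A by (simp add: bounded_linear.linear linear_diff)

text \<open>The coupling through \<open>A\<close> and \<open>B\<close> is skew-adjoint, so its two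
  contributions cancel and only \<open>G\<close> remains.\<close>

lemma inner_velocity_diff:
  "inner (velocity u v - velocity u' v') ((u, v) - (u', v')) = - inner (G u - G u') (u - u')"
proof -
  define g \<beta> where "g = G u - G u'" and "\<beta> = B v - B v'"
  have "velocity u v - velocity u' v' = (- g - \<beta>, A (u - u'))"
    by (simp add: A_diff g_def \<beta>_def)
  moreover have "inner \<beta> (u - u') = inner (A (u - u')) (v - v')"
    using B_diff[of "u - u'" v v'] by (simp add: \<beta>_def inner_commute)
  ultimately have "inner (velocity u v - velocity u' v') (u - u', v - v') = - inner g (u - u')"
    by (simp only: inner_Pair inner_diff_left[of "- g"] inner_minus_left)
  then show ?thesis
    by (simp add: g_def)
qed

text \<open>The derivative is twice the inner product in \<open>inner_velocity_diff\<close>, so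
  strong monotonicity gives dissipation in the \<open>x\<close>-component alone.\<close>

lemma contraction:
  assumes "trajectory x l" "trajectory y m" "t \<ge> 0"
  shows "\<exists>D \<le> - 2 * \<alpha> * (norm (x t - y t))\<^sup>2.
    ((\<lambda>t. (norm ((x t, l t) - (y t, m t)))\<^sup>2) has_real_derivative D) (at t within {0..})"
proof -
  have "((\<lambda>t. (x t, l t) - (y t, m t)) has_vector_derivative
      velocity (x t) (l t) - velocity (y t) (m t)) (at t within {0..})"
    using assms unfolding trajectory_def
    by (intro has_vector_derivative_diff has_vector_derivative_Pair) auto
  from has_real_derivative_norm_squared[OF this] show ?thesis
    unfolding inner_velocity_diff using mono[of "x t" "y t"]
    by (intro exI[of _ "2 * - inner (G (x t) - G (y t)) (x t - y t)"]) auto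
qed

lemma trajectory_shift:
  assumes "trajectory x l" "h \<ge> 0"
  shows "trajectory (\<lambda>t. x (t + h)) (\<lambda>t. l (t + h))"
proof -
  have *: "((\<lambda>t. u (t + h)) has_vector_derivative u') (at t within {0..})"
    if "(u has_vector_derivative u') (at (t + h) within {0..})" for u :: "real \<Rightarrow> 'c::real_normed_vector" and u' t
  proof -
    have "((\<lambda>t. t + h) has_vector_derivative 1) (at t within {0..})"
      by (auto intro!: derivative_eq_intros)
    \<comment> \<open>The shifted half-line is \<open>{h..}\<close>, which lies in
      \<open>{0..}\<close>, so the derivative restricts to it.\<close>
    moreover have "(u has_vector_derivative u') (at (t + h) within (\<lambda>t. t + h) ` {0..})"
      using that assms(2) by (rule_tac has_vector_derivative_within_subset) auto
    ultimately show ?thesis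
      using vector_diff_chain_within by (fastforce simp: o_def)
  qed
  show ?thesis
    using assms unfolding trajectory_def by (auto intro!: *)
qed

lemma trajectory_const:
  assumes "G \<xi> + B \<eta> = 0" "A \<xi> = b"
  shows "trajectory (\<lambda>_. \<xi>) (\<lambda>_. \<eta>)"
proof -
  have "- G \<xi> - B \<eta> = - (G \<xi> + B \<eta>)"
    by simp
  with assms show ?thesis
    by (simp add: trajectory_def)
qed

text \<open>Applied with a stationary point it controls \<open>V\<close>; applied with a time shift
  it controls the speed.\<close>

lemma dist_nonincreasing:
  assumes "trajectory x l" "trajectory y m" "0 \<le> s" "s \<le> t"
  shows "norm ((x t, l t) - (y t, m t)) \<le> norm ((x s, l s) - (y s, m s))"
proof -
  have "\<exists>D\<le>0. ((\<lambda>t. (norm ((x t, l t) - (y t, m t)))\<^sup>2) has_real_derivative D) (at r within {0..})"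
    if "r \<ge> 0" for r
  proof -
    have "- 2 * \<alpha> * (norm (x r - y r))\<^sup>2 \<le> 0"
      using pos by simp
    then show ?thesis
      using contraction[OF assms(1,2) that] order_trans by blast
  qed
  then have "(norm ((x t, l t) - (y t, m t)))\<^sup>2 \<le> (norm ((x s, l s) - (y s, m s)))\<^sup>2"
    using assms(3,4) by (intro nonincreasing_on_segment[where S = "{0..}"
          and g = "\<lambda>t. (norm ((x t, l t) - (y t, m t)))\<^sup>2"]) auto
  then show ?thesis
    by simp
qed

section \<open>One trajectory and one stationary point: energy decay and convergence\<close>

context
  fixes x :: "real \<Rightarrow> 'a" and l :: "real \<Rightarrow> 'b" and \<xi> \<eta>
  assumes traj: "trajectory x l"
    and eq: "G \<xi> + B \<eta> = 0" "A \<xi> = b"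
begin

abbreviation speed :: "real \<Rightarrow> real" where
  "speed t \<equiv> norm (velocity (x t) (l t))"

abbreviation V :: "real \<Rightarrow> real" where
  "V t \<equiv> (norm ((x t, l t) - (\<xi>, \<eta>)))\<^sup>2"

text \<open>Squared distance to the trajectory shifted by \<open>h\<close>. The quotient
  \<open>D h t / h\<^sup>2\<close> is a differentiable substitute for
  \<open>(speed t)\<^sup>2\<close>, whose own derivative would require one of
  \<open>G\<close>.\<close>

abbreviation D :: "real \<Rightarrow> real \<Rightarrow> real" where
  "D h t \<equiv> (norm ((x (t + h), l (t + h)) - (x t, l t)))\<^sup>2"

lemma z_deriv:
  "t \<ge> 0 \<Longrightarrow> ((\<lambda>t. (x t, l t)) has_vector_derivative velocity (x t) (l t)) (at t within {0..})"
  using traj unfolding trajectory_def by (intro has_vector_derivative_Pair) auto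

lemma V_nonincreasing: "0 \<le> s \<Longrightarrow> s \<le> t \<Longrightarrow> V t \<le> V s"
  using dist_nonincreasing[OF traj trajectory_const[OF eq]] by (simp add: power_mono)

lemma D_quotient_tendsto:
  assumes "t \<ge> 0"
  shows "((\<lambda>h. D h t / h\<^sup>2) \<longlongrightarrow> (speed t)\<^sup>2) (at_right 0)"
proof -
  let ?z = "\<lambda>t. (x t, l t)"
  have "(?z has_vector_derivative velocity (x t) (l t)) (at_right t)"
    using z_deriv[OF assms] by (rule has_vector_derivative_within_subset) (use assms in auto)
  from tendsto_power[OF tendsto_norm[OF has_vector_derivative_at_right_quotient[OF this]], of 2]
  moreover have "(norm ((1 / h) *\<^sub>R w))\<^sup>2 = (norm w)\<^sup>2 / h\<^sup>2" for h and w :: "'a \<times> 'b"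
    by (simp add: power_divide)
  ultimately show ?thesis
    by (simp only:)
qed

text \<open>A trajectory and its shift by \<open>h\<close> never move apart; divide by
  \<open>h\<^sup>2\<close> and let \<open>h\<close> tend to 0.\<close>

lemma speed_nonincreasing:
  assumes "0 \<le> s" "s \<le> t"
  shows "speed t \<le> speed s"
proof -
  have "(speed t)\<^sup>2 \<le> (speed s)\<^sup>2"
  proof (rule tendsto_le)
    show "\<forall>\<^sub>F h in at_right 0. D h t / h\<^sup>2 \<le> D h s / h\<^sup>2"
      using eventually_at_right_less[of 0]
    proof eventually_elim
      case (elim h)
      then show ?case
        using dist_nonincreasing[OF trajectory_shift[OF traj] traj assms, of h]
        by (intro divide_right_mono power_mono) auto
    qed
  qed (use assms D_quotient_tendsto in auto)
  then show ?thesis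
    by simp
qed

text \<open>The mean value inequality bounds the increment by \<open>h\<close> times the size of
  \<open>A (x c - \<xi>)\<close> at some intermediate \<open>c\<close>, and \<open>x c\<close> lies
  within \<open>e\<close> of \<open>x r\<close>.\<close>

lemma multiplier_increment:
  assumes K: "\<And>u. norm (A u) \<le> norm u * K" "K \<ge> 0" and "0 < h" "0 \<le> r"
    and small: "\<And>c. 0 < c \<Longrightarrow> c < h \<Longrightarrow> norm ((x c, l c) - (x 0, l 0)) \<le> e"
  shows "norm (l (r + h) - l r) \<le> h * K * (norm (x r - \<xi>) + e)"
proof -
  have ld: "(l has_vector_derivative A (x c) - b) (at c within {0..})" if "c \<ge> 0" for c
    using traj that by (simp add: trajectory_def)
  have "\<exists>c\<in>{r<..<r + h}. norm (l (r + h) - l r) \<le> norm ((r + h - r) *\<^sub>R (A (x c) - b))"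
  proof (rule mvt_general)
    show "continuous_on {r..r + h} l"
    proof (rule continuous_on_subset)
      show "continuous_on {0..} l"
        unfolding continuous_on_eq_continuous_within
        using has_vector_derivative_continuous[OF ld] by simp
    qed (use assms(4) in auto)
  next
    fix c assume c: "r < c" "c < r + h"
    then have "at c within {0..} = at c"
      using assms(4) by (intro at_within_interior) (simp add: interior_Ici)
    then show "(l has_derivative (\<lambda>h. h *\<^sub>R (A (x c) - b))) (at c)"
      using ld[of c] c assms(4) by (simp add: has_vector_derivative_def)
  qed (use assms(3) in simp)
  then obtain c where c: "r < c" "c < r + h" "norm (l (r + h) - l r) \<le> h * norm (A (x c - \<xi>))"
    using assms(3) eq(2) by (auto simp: A_diff)
  define k where "k = c - r"
  have "norm (x c - x r) \<le> norm ((x (r + k), l (r + k)) - (x r, l r))"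
    using norm_fst_le[of "x c - x r" "l c - l r"] by (simp add: k_def)
  \<comment> \<open>Contraction between the trajectory and its shift by \<open>k\<close> moves the
    comparison to time 0, so a single \<open>e\<close> serves every \<open>r\<close>.\<close>
  also have "\<dots> \<le> norm ((x (0 + k), l (0 + k)) - (x 0, l 0))"
    using c assms(4) by (intro dist_nonincreasing trajectory_shift traj) (auto simp: k_def)
  also have "\<dots> \<le> e"
    using small[of k] c by (simp add: k_def)
  finally have "norm (x c - \<xi>) \<le> norm (x r - \<xi>) + e"
    using norm_triangle_ineq[of "x r - \<xi>" "x c - x r"] by simp
  then have "norm (A (x c - \<xi>)) \<le> (norm (x r - \<xi>) + e) * K"
    using K(1)[of "x c - \<xi>"] K(2) by (meson mult_right_mono order_trans)
  then have "h * norm (A (x c - \<xi>)) \<le> h * ((norm (x r - \<xi>) + e) * K)"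
    using assms(3) by (intro mult_left_mono) auto
  then show ?thesis
    using c(3) by (simp add: mult_ac)
qed

text \<open>Strong monotonicity bounds the \<open>x\<close>-part of the increment by the decay of \<open>D h\<close> and, because
  \<open>l' = A (x - \<xi>)\<close>, the multiplier part by the decay of \<open>V\<close>. The error \<open>e\<close> is the price for comparing
  the increment of \<open>l\<close> over \<open>[r, r + h]\<close> with its derivative at \<open>r\<close>.\<close>

lemma D_bound:
  assumes K: "\<And>u. norm (A u) \<le> norm u * K" "K \<ge> 0" and h: "0 < h" and "0 \<le> s" "s \<le> t"
    and small: "\<And>c. 0 < c \<Longrightarrow> c < h \<Longrightarrow> norm ((x c, l c) - (x 0, l 0)) \<le> e" and "e \<ge> 0"
  shows "(t - s) * (D h t / h\<^sup>2) \<le>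
    (D h s / h\<^sup>2 - D h t / h\<^sup>2) / (2 * \<alpha>) + K\<^sup>2 / \<alpha> * (V s - V t) + 2 * K\<^sup>2 * e\<^sup>2 * (t - s)"
proof -
  \<comment> \<open>The weights in \<open>g\<close> turn the dissipation of \<open>D h\<close> and
    of \<open>V\<close> into the two terms that bound \<open>c\<close> from above. Since
    \<open>D h r\<close> is at least \<open>D h t\<close>, this one constant serves the whole
    segment, and \<open>g\<close> is nonincreasing there.\<close>
  define c where "c = D h t / h\<^sup>2 - 2 * K\<^sup>2 * e\<^sup>2"
  define g where "g r = D h r / h\<^sup>2 / (2 * \<alpha>) + K\<^sup>2 / \<alpha> * V r + r * c" for r
  have le: "D h t \<le> D h r" if "0 \<le> r" "r \<le> t" for r
    using dist_nonincreasing[OF trajectory_shift[OF traj] traj that, of h] h by (simp add: power_mono)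
  have deriv: "\<exists>y\<le>0. (g has_real_derivative y) (at r within {0..})" if r: "0 \<le> r" "r \<le> t" for r
  proof -
    obtain d1 where d1: "d1 \<le> - 2 * \<alpha> * (norm (x (r + h) - x r))\<^sup>2"
        "(D h has_real_derivative d1) (at r within {0..})"
      using contraction[OF trajectory_shift[OF traj] traj r(1), of h] h by auto
    obtain d2 where d2: "d2 \<le> - 2 * \<alpha> * (norm (x r - \<xi>))\<^sup>2"
        "(V has_real_derivative d2) (at r within {0..})"
      using contraction[OF traj trajectory_const[OF eq] r(1)] by auto
    have "(norm (l (r + h) - l r))\<^sup>2 \<le> (h * K * (norm (x r - \<xi>) + e))\<^sup>2"
      using multiplier_increment[OF K h r(1) small] by (intro power_mono) auto
    also have "\<dots> = (h * K)\<^sup>2 * (norm (x r - \<xi>) + e)\<^sup>2"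
      by (simp add: power_mult_distrib)
    also have "\<dots> \<le> (h * K)\<^sup>2 * (2 * (norm (x r - \<xi>))\<^sup>2 + 2 * e\<^sup>2)"
      using sum_squares_bound[of "norm (x r - \<xi>)" e] by (intro mult_left_mono) (auto simp: power2_sum)
    finally have "D h r \<le> (norm (x (r + h) - x r))\<^sup>2 + h\<^sup>2 * (K\<^sup>2 * (2 * (norm (x r - \<xi>))\<^sup>2 + 2 * e\<^sup>2))"
      by (simp add: norm_Pair power_mult_distrib mult.assoc)
    then have "D h t \<le> (norm (x (r + h) - x r))\<^sup>2 + h\<^sup>2 * (K\<^sup>2 * (2 * (norm (x r - \<xi>))\<^sup>2 + 2 * e\<^sup>2))"
      using le[OF r] by linarith
    then have "D h t / h\<^sup>2 \<le> (norm (x (r + h) - x r))\<^sup>2 / h\<^sup>2 + K\<^sup>2 * (2 * (norm (x r - \<xi>))\<^sup>2 + 2 * e\<^sup>2)"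
      using h by (simp add: field_simps)
    then have "c \<le> (norm (x (r + h) - x r))\<^sup>2 / h\<^sup>2 + K\<^sup>2 * (2 * (norm (x r - \<xi>))\<^sup>2)"
      by (simp add: c_def algebra_simps)
    moreover have "d1 / h\<^sup>2 / (2 * \<alpha>) \<le> - ((norm (x (r + h) - x r))\<^sup>2 / h\<^sup>2)"
    proof -
      have "d1 / (h\<^sup>2 * (2 * \<alpha>)) \<le> - 2 * \<alpha> * (norm (x (r + h) - x r))\<^sup>2 / (h\<^sup>2 * (2 * \<alpha>))"
        using d1(1) h pos by (intro divide_right_mono) auto
      then show ?thesis
        using pos by simp
    qed
    moreover have "K\<^sup>2 / \<alpha> * d2 \<le> - (K\<^sup>2 * (2 * (norm (x r - \<xi>))\<^sup>2))"
    proof -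
      have "K\<^sup>2 / \<alpha> * d2 \<le> K\<^sup>2 / \<alpha> * (- 2 * \<alpha> * (norm (x r - \<xi>))\<^sup>2)"
        using d2(1) pos by (intro mult_left_mono) auto
      then show ?thesis
        using pos by (simp add: mult.left_commute)
    qed
    ultimately have "d1 / h\<^sup>2 / (2 * \<alpha>) + K\<^sup>2 / \<alpha> * d2 + c \<le> 0"
      by linarith
    moreover have "(g has_real_derivative d1 / h\<^sup>2 / (2 * \<alpha>) + K\<^sup>2 / \<alpha> * d2 + 1 * c) (at r within {0..})"
      unfolding g_def
      by (intro DERIV_add DERIV_cdivide DERIV_cmult DERIV_cmult_right DERIV_ident d1 d2)
    ultimately show ?thesis
      by auto
  qed
  have "g t \<le> g s"
  proof (rule nonincreasing_on_segment[where S = "{0..}" and g = g])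
    show "\<exists>y\<le>0. (g has_real_derivative y) (at r within {0..})" if "r \<in> {s..t}" for r
      using deriv[of r] that assms(4) by simp
  qed (use assms(4,5) in auto)
  then have "(t - s) * c \<le> (D h s / h\<^sup>2 - D h t / h\<^sup>2) / (2 * \<alpha>) + K\<^sup>2 / \<alpha> * (V s - V t)"
    by (simp add: g_def algebra_simps diff_divide_distrib)
  then show ?thesis
    by (simp add: c_def algebra_simps)
qed

text \<open>Two limits in \<open>D_bound\<close>: first \<open>h\<close> tends to 0 with
  \<open>e\<close> fixed, which yields the speeds, then \<open>e\<close> tends to 0, which removes
  the error term.\<close>

lemma energy_inequality:
  assumes K: "\<And>u. norm (A u) \<le> norm u * K" "K \<ge> 0" and st: "0 \<le> s" "s \<le> t"
  shows "(t - s) * (speed t)\<^sup>2 \<le>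
    ((speed s)\<^sup>2 - (speed t)\<^sup>2) / (2 * \<alpha>) + K\<^sup>2 / \<alpha> * (V s - V t)" (is "?l \<le> ?r")
proof -
  have le: "?l \<le> ?r + 2 * K\<^sup>2 * e\<^sup>2 * (t - s)" if "e > 0" for e
  proof (rule tendsto_le[OF trivial_limit_at_right_real])
    \<comment> \<open>Continuity at time 0 provides a \<open>k\<close> such that every
      \<open>h\<close> below it meets the smallness hypothesis of \<open>D_bound\<close>.\<close>
    have "((\<lambda>t. (x t, l t)) \<longlongrightarrow> (x 0, l 0)) (at_right 0)"
      using has_vector_derivative_continuous[OF z_deriv[OF order_refl]]
      unfolding continuous_within by (rule tendsto_within_subset) auto
    from tendstoD[OF this \<open>e > 0\<close>]
    have "\<forall>\<^sub>F c in at_right 0. norm ((x c, l c) - (x 0, l 0)) < e"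
      by (simp only: dist_norm)
    then obtain k where k: "k > 0" "\<And>c. 0 < c \<Longrightarrow> c < k \<Longrightarrow> norm ((x c, l c) - (x 0, l 0)) < e"
      unfolding eventually_at_right[OF zero_less_one] by blast
    have "\<forall>\<^sub>F h in at_right 0. 0 < h \<and> h < k"
      unfolding eventually_at_right[OF zero_less_one] using k(1) by blast
    then show "\<forall>\<^sub>F h in at_right 0. (t - s) * (D h t / h\<^sup>2) \<le>
        (D h s / h\<^sup>2 - D h t / h\<^sup>2) / (2 * \<alpha>) + K\<^sup>2 / \<alpha> * (V s - V t) + 2 * K\<^sup>2 * e\<^sup>2 * (t - s)"
    proof eventually_elim
      case (elim h)
      show ?case
      proof (rule D_bound[OF K _ st])
        show "norm ((x c, l c) - (x 0, l 0)) \<le> e" if "0 < c" "c < h" for c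
          by (rule less_imp_le[OF k(2)]) (use that elim in auto)
      qed (use elim that in auto)
    qed
    show "((\<lambda>h. (t - s) * (D h t / h\<^sup>2)) \<longlongrightarrow> ?l) (at_right 0)"
      by (rule tendsto_mult[OF tendsto_const D_quotient_tendsto]) (use st in simp)
    show "((\<lambda>h. (D h s / h\<^sup>2 - D h t / h\<^sup>2) / (2 * \<alpha>) + K\<^sup>2 / \<alpha> * (V s - V t) +
        2 * K\<^sup>2 * e\<^sup>2 * (t - s)) \<longlongrightarrow> ?r + 2 * K\<^sup>2 * e\<^sup>2 * (t - s)) (at_right 0)"
      by (rule tendsto_add[OF tendsto_add[OF tendsto_divide[OF tendsto_diff[OF
                  D_quotient_tendsto D_quotient_tendsto] tendsto_const] tendsto_const] tendsto_const])
        (use st pos in auto)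
  qed
  have "((\<lambda>e. ?r + 2 * K\<^sup>2 * e\<^sup>2 * (t - s)) \<longlongrightarrow> ?r + 2 * K\<^sup>2 * 0\<^sup>2 * (t - s)) (at_right 0)"
    by (intro tendsto_intros)
  moreover have "\<forall>\<^sub>F e in at_right 0. ?l \<le> ?r + 2 * K\<^sup>2 * e\<^sup>2 * (t - s)"
    using eventually_at_right_less[of 0] by eventually_elim (rule le)
  ultimately have "?l \<le> ?r + 2 * K\<^sup>2 * 0\<^sup>2 * (t - s)"
    using tendsto_lowerbound trivial_limit_at_right_real by blast
  then show ?thesis
    by simp
qed

text \<open>\<open>H\<close> collects the quantities whose decrease appears in
  \<open>energy_inequality\<close>. With \<open>s = t / 2\<close>, half of
  \<open>t * (speed t)\<^sup>2\<close> is at most \<open>H (t / 2) - H t\<close>.\<close>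

lemma speed_smallo: "speed \<in> o[at_top](\<lambda>t. 1 / sqrt t)"
proof -
  obtain K where K: "\<And>u. norm (A u) \<le> norm u * K" "K \<ge> 0"
    using bounded_linear.nonneg_bounded[OF A] by blast
  define H where "H t = (speed t)\<^sup>2 / (2 * \<alpha>) + K\<^sup>2 / \<alpha> * V t" for t
  have lim: "((\<lambda>t. 2 * (H (t / 2) - H t)) \<longlongrightarrow> 2 * 0) at_top"
  proof (intro tendsto_mult tendsto_const tendsto_half_diff_nonincreasing)
    show "H t \<le> H s" if "0 \<le> s" "s \<le> t" for s t
      unfolding H_def using that pos speed_nonincreasing[OF that] V_nonincreasing[OF that]
      by (intro add_mono divide_right_mono mult_left_mono power_mono) auto
    show "0 \<le> H t" for t
      using pos by (simp add: H_def)
  qed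
  have "((\<lambda>t. (speed t * sqrt t)\<^sup>2) \<longlongrightarrow> 0) at_top"
  proof (rule tendsto_sandwich[OF _ _ tendsto_const])
    show "((\<lambda>t. 2 * (H (t / 2) - H t)) \<longlongrightarrow> 0) at_top"
      using lim by simp
    show "\<forall>\<^sub>F t in at_top. (speed t * sqrt t)\<^sup>2 \<le> 2 * (H (t / 2) - H t)"
      using eventually_ge_at_top[of 0]
    proof eventually_elim
      case (elim t)
      have "(t - t / 2) * (speed t)\<^sup>2 \<le> H (t / 2) - H t"
        using energy_inequality[OF K, of "t / 2" t] elim
        by (simp only: H_def) (simp add: diff_divide_distrib right_diff_distrib)
      then show ?case
        using elim by (simp add: power_mult_distrib algebra_simps)
    qed
  qed auto
  from tendsto_real_sqrt[OF this] have "((\<lambda>t. \<bar>speed t * sqrt t\<bar>) \<longlongrightarrow> 0) at_top"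
    by (simp only: real_sqrt_abs real_sqrt_zero)
  then have "((\<lambda>t. speed t / (1 / sqrt t)) \<longlongrightarrow> 0) at_top"
    by (simp only: tendsto_rabs_zero_iff) simp
  then show ?thesis
    by (rule smalloI_tendsto) (use eventually_gt_at_top[of 0] in eventually_elim, simp)
qed

text \<open>The velocity vanishes at the stationary point, so the skew cancellation writes the left
  side as minus the inner product of the velocity with the displacement. Cauchy-Schwarz and the
  decay of \<open>V\<close> finish.\<close>

lemma gap_le_speed:
  assumes "t \<ge> 0"
  shows "inner (G (x t) - G \<xi>) (x t - \<xi>) \<le> speed t * sqrt (V 0)"
proof -
  have "velocity \<xi> \<eta> = 0"
    using trajectory_const[OF eq] eq by (simp add: zero_prod_def add_eq_0_iff2)
  then have "inner (G (x t) - G \<xi>) (x t - \<xi>) = - inner (velocity (x t) (l t)) ((x t, l t) - (\<xi>, \<eta>))"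
    using inner_velocity_diff[of "x t" "l t" \<xi> \<eta>] by simp
  also have "\<dots> \<le> speed t * norm ((x t, l t) - (\<xi>, \<eta>))"
    using Cauchy_Schwarz_ineq2[of "velocity (x t) (l t)" "(x t, l t) - (\<xi>, \<eta>)"] by linarith
  also have "\<dots> \<le> speed t * sqrt (V 0)"
    using V_nonincreasing[of 0 t] assms by (intro mult_left_mono) (auto intro: real_le_rsqrt)
  finally show ?thesis .
qed

lemma gap_smallo: "(\<lambda>t. inner (G (x t) - G \<xi>) (x t - \<xi>)) \<in> o[at_top](\<lambda>t. 1 / sqrt t)"
proof (rule landau_o.big_small_trans[OF bigoI speed_smallo])
  show "\<forall>\<^sub>F t in at_top. norm (inner (G (x t) - G \<xi>) (x t - \<xi>)) \<le> sqrt (V 0) * norm (speed t)"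
    using eventually_ge_at_top[of 0]
  proof eventually_elim
    case (elim t)
    have "0 \<le> \<alpha> * (norm (x t - \<xi>))\<^sup>2"
      using pos by simp
    then show ?case
      using gap_le_speed[OF elim] mono[of "x t" \<xi>] by (simp add: mult.commute)
  qed
qed

text \<open>Strong monotonicity bounds \<alpha> times the squared distance from \<open>x t\<close>
  to \<xi> by the monotonicity gap, which tends to 0.\<close>

lemma x_tendsto: "(x \<longlongrightarrow> \<xi>) at_top"
proof -
  have "((\<lambda>t. inner (G (x t) - G \<xi>) (x t - \<xi>) / \<alpha>) \<longlongrightarrow> 0 / \<alpha>) at_top"
    using pos by (intro tendsto_divide tendsto_const tendsto_0_if_smallo_inverse_sqrt gap_smallo) simp
  then have lim: "((\<lambda>t. inner (G (x t) - G \<xi>) (x t - \<xi>) / \<alpha>) \<longlongrightarrow> 0) at_top"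
    by simp
  have "((\<lambda>t. (norm (x t - \<xi>))\<^sup>2) \<longlongrightarrow> 0) at_top"
  proof (rule tendsto_sandwich[OF _ _ tendsto_const lim])
    have "(norm (x t - \<xi>))\<^sup>2 \<le> inner (G (x t) - G \<xi>) (x t - \<xi>) / \<alpha>" for t
      using mono[of "x t" \<xi>] pos by (simp add: pos_le_divide_eq mult.commute)
    then show "\<forall>\<^sub>F t in at_top. (norm (x t - \<xi>))\<^sup>2 \<le> inner (G (x t) - G \<xi>) (x t - \<xi>) / \<alpha>"
      by simp
  qed auto
  from tendsto_real_sqrt[OF this] show ?thesis
    by (simp add: tendsto_norm_zero_iff LIM_zero_iff)
qed

text \<open>The component of \<open>l\<close> orthogonal to the range of \<open>A\<close> does not move, and on the range of \<open>A\<close>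
  the strong convergence of \<open>B (l t)\<close> forces weak convergence; this identifies the weak limit without
  any weak compactness argument.\<close>

lemma weak_limit:
  assumes cont: "isCont G \<xi>"
  obtains lb where "\<And>u. inner (A u) (lb - \<eta>) = 0"
    "weakly_tendsto (\<lambda>t. (x t, l t)) (\<xi>, lb) at_top"
proof -
  have sub: "subspace (closure (range A))"
    using A by (intro subspace_closure linear_subspace_image bounded_linear.linear) auto
  obtain p where p: "p \<in> closure (range A)"
      "\<And>v. v \<in> closure (range A) \<Longrightarrow> inner (l 0 - \<eta> - p) v = 0"
    using closed_subspace_orthogonal_projection[OF closed_closure sub] by blast
  \<comment> \<open>\<open>lb\<close> is the point nearest to \<open>l 0\<close> among the
    multipliers that agree with \<eta> when tested against the range of \<open>A\<close>.\<close>
  define lb where "lb = l 0 - p"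
  have perp: "inner (A u) (lb - \<eta>) = 0" for u
    using p(2)[of "A u"] closure_subset[of "range A"]
    by (auto simp: lb_def algebra_simps inner_commute)
  have range: "((\<lambda>t. inner (l t - lb) (A u)) \<longlongrightarrow> 0) at_top" for u
  proof -
    have G: "((\<lambda>t. G (x t) - G \<xi>) \<longlongrightarrow> G \<xi> - G \<xi>) at_top"
      by (intro tendsto_diff tendsto_const isCont_tendsto_compose[OF cont x_tendsto])
    have v: "((\<lambda>t. velocity (x t) (l t)) \<longlongrightarrow> 0) at_top"
      using tendsto_0_if_smallo_inverse_sqrt[OF speed_smallo] by (rule tendsto_norm_zero_cancel)
    \<comment> \<open>The \<open>x\<close>-equation expresses \<open>B (l t) - B \<eta>\<close>
      through the velocity and \<open>G (x t) - G \<xi>\<close>, both tending to 0; pairing with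
      \<open>u\<close> moves \<open>B\<close> over to \<open>A u\<close>.\<close>
    have "((\<lambda>t. inner u (- fst (velocity (x t) (l t)) - (G (x t) - G \<xi>)))
        \<longlongrightarrow> inner u (- fst (0 :: 'a \<times> 'b) - (G \<xi> - G \<xi>))) at_top"
      by (rule tendsto_inner[OF tendsto_const tendsto_diff[OF tendsto_minus[OF tendsto_fst[OF v]] G]])
    moreover have "inner u (- fst (velocity (x t) (l t)) - (G (x t) - G \<xi>)) = inner (l t - lb) (A u)" for t
    proof -
      have "B \<eta> = - G \<xi>"
        using eq(1) by (simp add: eq_neg_iff_add_eq_0 add.commute)
      then have "inner u (- fst (velocity (x t) (l t)) - (G (x t) - G \<xi>)) = inner u (B (l t) - B \<eta>)"
        by simp
      also have "\<dots> = inner (l t - lb) (A u)"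
        using perp[of u] unfolding B_diff by (simp add: inner_diff_right inner_diff_left inner_commute)
      finally show ?thesis .
    qed
    ultimately show ?thesis
      by simp
  qed
  have bdd: "\<forall>\<^sub>F t in at_top. norm (l t - lb) \<le> sqrt (V 0) + norm (\<eta> - lb)"
    using eventually_ge_at_top[of 0]
  proof eventually_elim
    case (elim t)
    have "norm (l t - \<eta>) \<le> sqrt (V t)"
      using norm_snd_le[of "l t - \<eta>" "x t - \<xi>"] by simp
    also have "\<dots> \<le> sqrt (V 0)"
      using V_nonincreasing[of 0 t] elim by simp
    finally show ?case
      using norm_triangle_ineq[of "l t - \<eta>" "\<eta> - lb"] by simp
  qed
  have weak: "((\<lambda>t. inner (l t - lb) w) \<longlongrightarrow> 0) at_top" for w
  proof -
    \<comment> \<open>Split \<open>w\<close> into \<open>v\<close> and an orthogonal remainder. The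
      remainder sees no motion, because \<open>A (x t) - b\<close> is in the range of
      \<open>A\<close>, and its constant value is 0 because \<open>l 0 - lb = p\<close>.\<close>
    obtain v where v: "v \<in> closure (range A)"
        "\<And>u. u \<in> closure (range A) \<Longrightarrow> inner (w - v) u = 0"
      using closed_subspace_orthogonal_projection[OF closed_closure sub] by blast
    have "((\<lambda>t. inner (l t) (w - v)) has_vector_derivative 0) (at t within {0..})" if "t \<in> {0..}" for t
    proof -
      have "(l has_vector_derivative A (x t) - b) (at t within {0..})"
        using traj that by (simp add: trajectory_def)
      from bounded_linear.has_vector_derivative[OF bounded_linear_inner_left this, of "w - v"]
      have "((\<lambda>t. inner (l t) (w - v)) has_vector_derivative inner (A (x t) - b) (w - v)) (at t within {0..})" .
      moreover have "A (x t) - b \<in> closure (range A)"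
        using eq(2) A_diff[of "x t" \<xi>] closure_subset[of "range A"] by (metis rangeI subsetD)
      ultimately show ?thesis
        using v(2) by (simp add: inner_commute)
    qed
    then obtain c where c: "\<And>t. t \<in> {0..} \<Longrightarrow> inner (l t) (w - v) = c"
      using has_vector_derivative_zero_constant[of "{0..}" "\<lambda>t. inner (l t) (w - v)"] by auto
    have "inner (l t - lb) (w - v) = 0" if "t \<ge> 0" for t
    proof -
      have "inner (l t - lb) (w - v) = inner (l 0 - lb) (w - v)"
        using c[of t] c[of 0] that by (simp add: inner_diff_left)
      also have "\<dots> = 0"
        using v(2)[OF p(1)] by (simp add: lb_def inner_commute)
      finally show ?thesis .
    qed
    then have "inner (l t - lb) v = inner (l t - lb) w" if "t \<ge> 0" for t
      using that by (simp add: inner_diff_right)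
    then have "\<forall>\<^sub>F t in at_top. inner (l t - lb) v = inner (l t - lb) w"
      by (rule eventually_mono[OF eventually_ge_at_top[of 0]])
    moreover have "((\<lambda>t. inner (l t - lb) v) \<longlongrightarrow> 0) at_top"
      by (rule tendsto_inner_closure[OF bdd _ v(1)]) (use range in auto)
    ultimately show ?thesis
      by (rule Lim_transform_eventually[rotated])
  qed
  have "((\<lambda>t. inner (x t - \<xi>) (fst w) + inner (l t - lb) (snd w)) \<longlongrightarrow> inner (\<xi> - \<xi>) (fst w) + 0) at_top"
    for w
    by (rule tendsto_add[OF tendsto_inner[OF tendsto_diff[OF x_tendsto tendsto_const] tendsto_const] weak])
  then have "weakly_tendsto (\<lambda>t. (x t, l t)) (\<xi>, lb) at_top"
    by (simp add: weakly_tendsto_iff_inner inner_prod_def)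
  with perp that show ?thesis
    by blast
qed

end

end

section \<open>Saddle points of the Lagrangian\<close>

text \<open>Maximality in the multiplier forces feasibility; minimality in the primal variable gives
  Fermat's condition for the Lagrangian at \<xi>.\<close>

lemma saddle_points_lagrangianD:
  fixes f :: "'a::{real_inner, complete_space} \<Rightarrow> real"
    and A :: "'a \<Rightarrow> 'b::{real_inner, complete_space}"
  assumes "(\<xi>, \<eta>) \<in> saddle_points (lagrangian f A b)"
    and "f differentiable (at \<xi>)" and A: "bounded_linear A"
  shows "A \<xi> = b" "gradient f \<xi> + adjoint A \<eta> = 0"
    "\<And>u. f \<xi> \<le> f u + inner \<eta> (A u - b)"
proof -
  have saddle: "f \<xi> + inner v (A \<xi> - b) \<le> f \<xi> + inner \<eta> (A \<xi> - b)"
    "f \<xi> + inner \<eta> (A \<xi> - b) \<le> f u + inner \<eta> (A u - b)" for u v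
    using assms(1) by (auto simp: saddle_points_def lagrangian_def)
  \<comment> \<open>Moving the multiplier in the direction of the residual turns the saddle
    inequality into a bound on the squared residual.\<close>
  have "inner (A \<xi> - b) (A \<xi> - b) \<le> 0"
    using saddle(1)[of "\<eta> + (A \<xi> - b)"] by (simp add: inner_add_left)
  then show "A \<xi> = b"
    using inner_ge_zero[of "A \<xi> - b"] by simp
  with saddle(2) show min: "f \<xi> \<le> f u + inner \<eta> (A u - b)" for u
    by simp
  have "((\<lambda>u. f u + inner \<eta> (A u - b)) has_derivative
      (\<lambda>h. inner h (gradient f \<xi>) + inner \<eta> (A h - 0))) (at \<xi>)"
    using GDERIV_gradient[OF assms(2)] unfolding gderiv_def
    by (intro has_derivative_add has_derivative_inner_right has_derivative_diff has_derivative_const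
        bounded_linear_imp_has_derivative A)
  then have "(\<lambda>h. inner h (gradient f \<xi>) + inner \<eta> (A h - 0)) = (\<lambda>h. 0)"
    by (rule has_derivative_local_min) (use saddle(2) in auto)
  then have "inner h (gradient f \<xi>) + inner \<eta> (A h) = 0" for h
    by (auto dest: fun_cong[of _ _ h])
  then have "inner h (gradient f \<xi> + adjoint A \<eta>) = 0" for h
    by (simp add: inner_add_right inner_commute[of \<eta>] adjoint_works_Hilbert[OF A])
  then show "gradient f \<xi> + adjoint A \<eta> = 0"
    using inner_eq_zero_iff by blast
qed

text \<open>Restriction to the line through \<open>u\<close> and \<open>v\<close> reduces the claim
  to the tangent inequality for convex functions of one real variable.\<close>

lemma convex_gradient_inequality:
  fixes f :: "'a::{real_inner, complete_space} \<Rightarrow> real"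
  assumes "convex_on UNIV f" "f differentiable (at u)"
  shows "f u + inner (gradient f u) (v - u) \<le> f v"
proof -
  let ?g = "\<lambda>t. f (u + t *\<^sub>R (v - u))"
  have "convex_on UNIV ?g"
  proof (rule convex_onI)
    fix t r s :: real assume t: "0 < t" "t < 1"
    have "u + ((1 - t) *\<^sub>R r + t *\<^sub>R s) *\<^sub>R (v - u) =
        (1 - t) *\<^sub>R (u + r *\<^sub>R (v - u)) + t *\<^sub>R (u + s *\<^sub>R (v - u))"
      by (simp add: algebra_simps)
    then show "?g ((1 - t) *\<^sub>R r + t *\<^sub>R s) \<le> (1 - t) * ?g r + t * ?g s"
      using convex_onD[OF assms(1), of t "u + r *\<^sub>R (v - u)" "u + s *\<^sub>R (v - u)"] t by simp
  qed simp
  moreover have "(?g has_real_derivative inner (gradient f u) (v - u)) (at 0)"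
  proof -
    have "(f has_derivative (\<lambda>h. inner h (gradient f u))) (at (u + 0 *\<^sub>R (v - u)))"
      using GDERIV_gradient[OF assms(2)] by (simp add: gderiv_def)
    moreover have "((\<lambda>t. u + t *\<^sub>R (v - u)) has_derivative (\<lambda>t. t *\<^sub>R (v - u))) (at (0::real))"
      by (auto intro!: derivative_eq_intros)
    ultimately have "(?g has_derivative (\<lambda>t. inner (t *\<^sub>R (v - u)) (gradient f u))) (at 0)"
      by (rule has_derivative_compose[rotated])
    then show ?thesis
      by (simp add: has_field_derivative_def inner_commute mult_commute_abs)
  qed
  ultimately have "?g 1 - ?g 0 \<ge> inner (gradient f u) (v - u) * (1 - 0)"
    by (intro convex_on_imp_above_tangent[where A = UNIV]) auto
  then show ?thesis
    by simp
qed

section \<open>Component derivatives on the half-line, and the final assembly\<close>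

lemma C1_within_PairD:
  assumes "C1_within S (\<lambda>t. (x t, l t))" "t \<in> S" "at t within S \<noteq> bot"
  shows "(x has_vector_derivative vector_derivative x (at t within S)) (at t within S)"
    "(l has_vector_derivative vector_derivative l (at t within S)) (at t within S)"
proof -
  obtain d where d: "((\<lambda>t. (x t, l t)) has_vector_derivative d) (at t within S)"
    using assms(1,2) unfolding C1_within_def by blast
  have x: "(x has_vector_derivative fst d) (at t within S)"
    using bounded_linear.has_vector_derivative[OF bounded_linear_fst d] by simp
  show "(x has_vector_derivative vector_derivative x (at t within S)) (at t within S)"
    unfolding vector_derivative_within[OF assms(3) x] by (rule x)
  have l: "(l has_vector_derivative snd d) (at t within S)"
    using bounded_linear.has_vector_derivative[OF bounded_linear_snd d] by simp
  show "(l has_vector_derivative vector_derivative l (at t within S)) (at t within S)"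
    unfolding vector_derivative_within[OF assms(3) l] by (rule l)
qed

text \<open>A nontrivial filter makes the derivative within \<open>{a..}\<close> unique, including
  at the endpoint, so that \<open>vector_derivative\<close> picks it out.\<close>

lemma at_within_atLeast_neq_bot: "t \<ge> a \<Longrightarrow> at t within {a..} \<noteq> bot" for t :: real
proof -
  assume "t \<ge> a"
  then have "at_right t \<le> at t within {a..}"
    by (intro at_le) auto
  then show ?thesis
    using trivial_limit_at_right_real[of t] by (metis bot.extremum_uniqueI)
qed

theorem theorem3p1:
  fixes f :: "'a::{real_inner, complete_space} \<Rightarrow> real"
    and A :: "'a \<Rightarrow> 'b::{real_inner, complete_space}"
    and b :: 'b
    and \<alpha> :: real
    and x0 :: 'a and l0 :: 'b
    and x :: "real \<Rightarrow> 'a" and l :: "real \<Rightarrow> 'b"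
  assumes "convex_on UNIV f"
    and "continuously_differentiable f"
    and "lipschitz_on_bounded_sets (gradient f)"
    and "bounded_linear A"
    and "\<alpha> > 0"
    and "strongly_monotone \<alpha> (gradient f)"
    and "saddle_points (lagrangian f A b) \<noteq> {}"
    and "AH_solution f A b x0 l0 x l"
  shows "(\<forall>(\<xi>, \<eta>) \<in> saddle_points (lagrangian f A b).
            (\<lambda>t. lagrangian f A b (x t) \<eta> - lagrangian f A b \<xi> (l t)) \<in> o[at_top](\<lambda>t. 1 / sqrt t) \<and>
            (\<lambda>t. norm (time_derivative x t, time_derivative l t)) \<in> o[at_top](\<lambda>t. 1 / sqrt t)) \<and>
         (\<exists>(xb, lb) \<in> saddle_points (lagrangian f A b).
            weakly_tendsto (\<lambda>t. (x t, l t)) (xb, lb) at_top)"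
proof -
  interpret arrow_hurwicz "gradient f" A "adjoint A" b \<alpha>
    by (rule arrow_hurwicz.intro)
      (use assms(4-6) adjoint_works_Hilbert[OF assms(4)] in \<open>auto simp: strongly_monotone_def\<close>)
  have diff: "f differentiable (at u)" for u
    using assms(2) by (simp add: continuously_differentiable_def)
  have velocity: "(time_derivative x t, time_derivative l t) = velocity (x t) (l t)" if "t \<ge> 0" for t
  proof -
    have "time_derivative x t + gradient f (x t) + adjoint A (l t) = 0" "time_derivative l t + b - A (x t) = 0"
      using assms(8) that by (auto simp: AH_solution_def)
    then show ?thesis
      by (simp add: algebra_simps eq_neg_iff_add_eq_0)
  qed
  have traj: "trajectory x l"
    unfolding trajectory_def
  proof (intro allI impI)
    fix t :: real assume t: "t \<ge> 0"
    have "C1_within {0..} (\<lambda>t. (x t, l t))"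
      using assms(8) by (simp add: AH_solution_def)
    from C1_within_PairD[OF this _ at_within_atLeast_neq_bot[OF t]] velocity[OF t] t
    show "(x has_vector_derivative - gradient f (x t) - adjoint A (l t)) (at t within {0..}) \<and>
        (l has_vector_derivative A (x t) - b) (at t within {0..})"
      by simp
  qed
  note saddleD = saddle_points_lagrangianD[OF _ diff assms(4)]
  have "(\<lambda>t. lagrangian f A b (x t) \<eta> - lagrangian f A b \<xi> (l t)) \<in> o[at_top](\<lambda>t. 1 / sqrt t)"
      "(\<lambda>t. norm (time_derivative x t, time_derivative l t)) \<in> o[at_top](\<lambda>t. 1 / sqrt t)"
    if saddle: "(\<xi>, \<eta>) \<in> saddle_points (lagrangian f A b)" for \<xi> \<eta>
  proof -
    note eq = saddleD(2,1)[OF saddle]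
    have B\<eta>: "adjoint A \<eta> = - gradient f \<xi>"
      using eq(1) by (simp add: eq_neg_iff_add_eq_0 add.commute)
    \<comment> \<open>The saddle property makes the gap nonnegative. Convexity at \<open>x t\<close>
      bounds \<open>f (x t) - f \<xi>\<close>, and stationarity turns the term with \<eta> into the
      one with the gradient at \<xi>.\<close>
    have "\<bar>lagrangian f A b (x t) \<eta> - lagrangian f A b \<xi> (l t)\<bar> \<le>
        \<bar>inner (gradient f (x t) - gradient f \<xi>) (x t - \<xi>)\<bar>" for t
    proof -
      have "lagrangian f A b (x t) \<eta> - lagrangian f A b \<xi> (l t) = f (x t) + inner \<eta> (A (x t) - b) - f \<xi>"
        using eq(2) by (simp add: lagrangian_def)
      moreover have "inner \<eta> (A (x t) - b) = - inner (gradient f \<xi>) (x t - \<xi>)"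
        unfolding eq(2)[symmetric] A_diff[symmetric] inner_commute[of \<eta>] adj B\<eta>
        by (simp add: inner_commute)
      moreover have "inner (gradient f (x t)) (\<xi> - x t) = - inner (gradient f (x t)) (x t - \<xi>)"
        by (simp add: inner_diff_right)
      ultimately show ?thesis
        using saddleD(3)[OF saddle, of "x t"]
          convex_gradient_inequality[OF assms(1) diff, of "x t" \<xi>]
        by (simp add: inner_diff_left[of "gradient f (x t)"])
    qed
    then have "(\<lambda>t. lagrangian f A b (x t) \<eta> - lagrangian f A b \<xi> (l t)) \<in>
        O[at_top](\<lambda>t. inner (gradient f (x t) - gradient f \<xi>) (x t - \<xi>))"
      by (intro bigoI[of _ 1]) simp
    then show "(\<lambda>t. lagrangian f A b (x t) \<eta> - lagrangian f A b \<xi> (l t)) \<in> o[at_top](\<lambda>t. 1 / sqrt t)"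
      using gap_smallo[OF traj eq] by (rule landau_o.big_small_trans)
    have "\<forall>\<^sub>F t in at_top. norm (time_derivative x t, time_derivative l t) = norm (velocity (x t) (l t))"
      using eventually_ge_at_top[of 0] by eventually_elim (simp only: velocity)
    from landau_o.small.in_cong[OF this] speed_smallo[OF traj eq]
    show "(\<lambda>t. norm (time_derivative x t, time_derivative l t)) \<in> o[at_top](\<lambda>t. 1 / sqrt t)"
      by blast
  qed
  moreover have "\<exists>(xb, lb) \<in> saddle_points (lagrangian f A b).
      weakly_tendsto (\<lambda>t. (x t, l t)) (xb, lb) at_top"
  proof -
    obtain \<xi> \<eta> where saddle: "(\<xi>, \<eta>) \<in> saddle_points (lagrangian f A b)"
      using assms(7) by auto
    note eq = saddleD(2,1)[OF saddle]
    have "isCont (gradient f) \<xi>"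
      using assms(2) by (simp add: continuously_differentiable_def continuous_on_eq_continuous_at)
    from weak_limit[OF traj eq this]
    obtain lb where lb: "\<And>u. inner (A u) (lb - \<eta>) = 0"
        "weakly_tendsto (\<lambda>t. (x t, l t)) (\<xi>, lb) at_top"
      by blast
    \<comment> \<open>As \<open>A \<xi> = b\<close>, the vector \<open>A u - b\<close> lies in the
      range of \<open>A\<close>, where \<open>lb\<close> and \<eta> act alike. The Lagrangians with
      these multipliers coincide, so the saddle property passes to \<open>lb\<close>.\<close>
    have "inner lb (A u - b) = inner \<eta> (A u - b)" for u
      using lb(1)[of "u - \<xi>"] by (simp add: A_diff eq(2) inner_diff_right inner_commute)
    then have "(\<xi>, lb) \<in> saddle_points (lagrangian f A b)"
      using saddleD(3)[OF saddle] eq(2) by (simp add: saddle_points_def lagrangian_def)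
    with lb(2) show ?thesis
      by blast
  qed
  ultimately show ?thesis
    by blast
qed

end
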